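(* Let $(u^*,\alpha^* )$, with $u^*:S\to\mathbb{R}$ and $\alpha^*\in[0,1]$, be a solution of the constant-gain robust Bellman equation $$u^*(s)=\sup_{\phi\in Q}\inf_{p_s\in\mathcal{P}_s}\sum_{a\in A}\sum_{s'\in S}\phi(a)p_s(s'|a)\big[r(s,a)-\alpha^*+u^*(s')\big]\qquad\forall s\in S.$$ Suppose that for some $\epsilon\ge 0$ and some stationary policy $\Delta:S\to Q$, $$u^*(s)\le\inf_{p_s\in\mathcal{P}_s}\sum_{a\in A}\sum_{s'\in S}\Delta(a|s)p_s(s'|a)\big[r(s,a)-\alpha^*+u^*(s')\big]+\epsilon\qquad\forall s\in S.$$ Then $\Delta$ is $\epsilon$-optimal among all stationary policies, i.e. for $K=K_H$ or $K=K_S$ and every $\mu\in\mathrm{Prob}(S)$, $$\overline\alpha(\mu,\Pi_S,K)-\inf_{\kappa\in K}\underline\alpha(\mu,\Delta,\kappa)\le\epsilon.$$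
   Context: $S$ (states) and $A$ (actions) are finite nonempty sets; $\mathrm{Prob}(E)$ is the set of probability distributions on a finite set $E$; $r:S\times A\to[0,1]$ is a reward function. $Q\subseteq\mathrm{Prob}(A)$ is an arbitrary nonempty set (controller's admissible randomized actions). For each $s\in S$, $\mathcal{P}_s$ is an arbitrary nonempty set of maps $p_s:A\to\mathrm{Prob}(S)$, written $p_s(s'|a)$; $\mathcal{P}=\prod_{s\in S}\mathcal{P}_s$ is the (S-rectangular) ambiguity set, and $p\in\mathcal{P}$ is written $p(s'|s,a)=p_s(s'|a)$. Histories: $h_t=(s_0,a_0,\dots,s_{t-1},a_{t-1},s_t)\in(S\times A)^t\times S$. A history-dependent controller policy is $\pi=(\pi_0,\pi_1,\dots)$ with $\pi_t(\cdot|h_t)\in Q$ for all $t,h_t$. $\Pi_S$ is the set of stationary ones, $\pi_t(\cdot|h_t)=\Delta(\cdot|s_t)$ for a single map $\Delta:S\to Q$; such a policy is identified with $\Delta$. $K_H$ is the set of history-dependent adversary policies $\kappa=(\kappa_0,\kappa_1,\dots)$ where $\kappa_t(s'|h_t,a)$ is such that $\kappa_t(\cdot|h_t,\cdot)\in\mathcal{P}_{s_t}$ for all $t$, $h_t$. $K_S\subseteq K_H$ is the set of stationary ones, $\kappa_t(s'|h_t,a)=p(s'|s_t,a)$ for a single $p\in\mathcal{P}$. For $\mu\in\mathrm{Prob}(S)$, $\pi$, $\kappa$, $E_\mu^{\pi,\kappa}$ is expectation under the law of $(X_0,A_0,X_1,A_1,\dots)$ with $X_0\sim\mu$, $A_t\sim\pi_t(\cdot|H_t)$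 given $H_t=(X_0,A_0,\dots,X_t)$, and $X_{t+1}\sim\kappa_t(\cdot|H_t,A_t)$ given $(H_t,A_t)$. Define $$\overline\alpha(\mu,\pi,\kappa)=\limsup_{n\to\infty}E_\mu^{\pi,\kappa}\frac1n\sum_{k=0}^{n-1}r(X_k,A_k),\quad \underline\alpha(\mu,\pi,\kappa)=\liminf_{n\to\infty}E_\mu^{\pi,\kappa}\frac1n\sum_{k=0}^{n-1}r(X_k,A_k),$$ and $\overline\alpha(\mu,\Pi_S,K)=\sup_{\pi\in\Pi_S}\inf_{\kappa\in K}\overline\alpha(\mu,\pi,\kappa)$. *)

theory Defs
  imports "HOL-Probability.Probability"
begin

text \<open>
  The finite nonempty sets of states and actions are types \<open>'s\<close>, \<open>'a\<close> of class
  \<open>finite\<close>, and \<open>Prob(E)\<close> is the type of probability mass functions on \<open>E\<close>.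
  A history \<open>h\<^sub>t = (s\<^sub>0, a\<^sub>0, \<dots>, s\<^sub>t\<^sub>-\<^sub>1, a\<^sub>t\<^sub>-\<^sub>1, s\<^sub>t)\<close> is split into the
  chronological list of the \<open>t\<close> past state-action pairs and the current state \<open>s\<^sub>t\<close>. The time
  \<open>t\<close> is the length of that list, so one function on histories of all lengths encodes the
  whole sequence \<open>(\<pi>\<^sub>t)\<^sub>t\<close> or \<open>(\<kappa>\<^sub>t)\<^sub>t\<close>.
\<close>

type_synonym ('s, 'a) controller = "('s \<times> 'a) list \<Rightarrow> 's \<Rightarrow> 'a pmf"
type_synonym ('s, 'a) adversary = "('s \<times> 'a) list \<Rightarrow> 's \<Rightarrow> 'a \<Rightarrow> 's pmf"

definition stationary :: "('s \<Rightarrow> 'b) \<Rightarrow> ('s \<times> 'a) list \<Rightarrow> 's \<Rightarrow> 'b" where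
  "stationary d = (\<lambda>hs s. d s)"

definition Pi_H :: "'a pmf set \<Rightarrow> ('s, 'a) controller set" where
  "Pi_H Q = {\<pi>. \<forall>hs s. \<pi> hs s \<in> Q}"

definition Pi_S :: "'a pmf set \<Rightarrow> ('s, 'a) controller set" where
  "Pi_S Q = {stationary \<Delta> | \<Delta>. \<forall>s. \<Delta> s \<in> Q}"

definition K_H :: "('s \<Rightarrow> ('a \<Rightarrow> 's pmf) set) \<Rightarrow> ('s, 'a) adversary set" where
  "K_H P = {\<kappa>. \<forall>hs s. \<kappa> hs s \<in> P s}"

definition K_S :: "('s \<Rightarrow> ('a \<Rightarrow> 's pmf) set) \<Rightarrow> ('s, 'a) adversary set" where
  "K_S P = {stationary p | p. \<forall>s. p s \<in> P s}"

lemma Pi_S_subset_Pi_H: "Pi_S Q \<subseteq> Pi_H Q"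
  by (auto simp: Pi_S_def Pi_H_def stationary_def)

lemma K_S_subset_K_H: "K_S P \<subseteq> K_H P"
  by (auto simp: K_S_def K_H_def stationary_def)

text \<open>
  Law of the history \<open>H\<^sub>n = (X\<^sub>0, A\<^sub>0, \<dots>, X\<^sub>n\<^sub>-\<^sub>1, A\<^sub>n\<^sub>-\<^sub>1, X\<^sub>n)\<close>. These are the finite-dimensional marginals
  of the law of the whole process; they suffice because every expectation below is that of a
  function of \<open>H\<^sub>n\<close>. Their consistency is lemma \<open>hist_law_consistent\<close>.
\<close>

primrec hist_law ::
  "'s pmf \<Rightarrow> ('s, 'a) controller \<Rightarrow> ('s, 'a) adversary \<Rightarrow> nat \<Rightarrow> (('s \<times> 'a) list \<times> 's) pmf" where
  "hist_law \<mu> \<pi> \<kappa> 0 = map_pmf (\<lambda>s. ([], s)) \<mu>"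
| "hist_law \<mu> \<pi> \<kappa> (Suc n) =
     bind_pmf (hist_law \<mu> \<pi> \<kappa> n) (\<lambda>(hs, s).
     bind_pmf (\<pi> hs s) (\<lambda>a.
     map_pmf (\<lambda>s'. (hs @ [(s, a)], s')) (\<kappa> hs s a)))"

lemma hist_law_consistent:
  "map_pmf (\<lambda>(hs, s). (butlast hs, fst (last hs))) (hist_law \<mu> \<pi> \<kappa> (Suc n)) = hist_law \<mu> \<pi> \<kappa> n"
  by (simp add: map_bind_pmf pmf.map_comp o_def case_prod_unfold bind_return_pmf')

lemma length_hist_law: "(hs, s) \<in> set_pmf (hist_law \<mu> \<pi> \<kappa> n) \<Longrightarrow> length hs = n"
  by (induction n arbitrary: hs s) auto

definition avg_reward ::
  "('s \<times> 'a \<Rightarrow> real) \<Rightarrow> 's pmf \<Rightarrow> ('s, 'a) controller \<Rightarrow> ('s, 'a) adversary \<Rightarrow> nat \<Rightarrow> real" where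
  "avg_reward r \<mu> \<pi> \<kappa> n =
     measure_pmf.expectation (hist_law \<mu> \<pi> \<kappa> n)
       (\<lambda>(hs, s). 1 / real n * (\<Sum>k<n. r (hs ! k)))"

text \<open>
  The long-run averages are taken in the extended reals, where \<open>limsup\<close>, \<open>liminf\<close> and the
  suprema and infima over policies exist unconditionally. For rewards in \<open>[0, 1]\<close> and nonempty
  sets of policies all these values lie in \<open>[0, 1]\<close>.
\<close>

definition alpha_upper ::
  "('s \<times> 'a \<Rightarrow> real) \<Rightarrow> 's pmf \<Rightarrow> ('s, 'a) controller \<Rightarrow> ('s, 'a) adversary \<Rightarrow> ereal" where
  "alpha_upper r \<mu> \<pi> \<kappa> = limsup (\<lambda>n. ereal (avg_reward r \<mu> \<pi> \<kappa> n))"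

definition alpha_lower ::
  "('s \<times> 'a \<Rightarrow> real) \<Rightarrow> 's pmf \<Rightarrow> ('s, 'a) controller \<Rightarrow> ('s, 'a) adversary \<Rightarrow> ereal" where
  "alpha_lower r \<mu> \<pi> \<kappa> = liminf (\<lambda>n. ereal (avg_reward r \<mu> \<pi> \<kappa> n))"

definition alpha_upper_value ::
  "('s \<times> 'a \<Rightarrow> real) \<Rightarrow> 's pmf \<Rightarrow> ('s, 'a) controller set \<Rightarrow> ('s, 'a) adversary set \<Rightarrow> ereal" where
  "alpha_upper_value r \<mu> C K = (SUP \<pi>\<in>C. INF \<kappa>\<in>K. alpha_upper r \<mu> \<pi> \<kappa>)"

definition bellman_sum ::
  "('s::finite \<times> 'a::finite \<Rightarrow> real) \<Rightarrow> real \<Rightarrow> ('s \<Rightarrow> real) \<Rightarrow> 's \<Rightarrow> 'a pmf \<Rightarrow> ('a \<Rightarrow> 's pmf) \<Rightarrow> real" where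
  "bellman_sum r \<alpha> u s \<phi> p =
     (\<Sum>a\<in>UNIV. \<Sum>s'\<in>UNIV. pmf \<phi> a * pmf (p a) s' * (r (s, a) - \<alpha> + u s'))"

text \<open>
  In the Bellman equation, \<open>SUP\<close> and \<open>INF\<close> over the reals are genuine suprema and infima: by
  the following bound the sums are bounded uniformly in \<open>\<phi>\<close> and \<open>p\<close>.
\<close>

lemma abs_bellman_sum_le:
  "\<bar>bellman_sum r \<alpha> u s \<phi> p\<bar> \<le> (\<Sum>a\<in>UNIV. \<Sum>s'\<in>UNIV. \<bar>r (s, a) - \<alpha> + u s'\<bar>)"
  unfolding bellman_sum_def
proof (intro order_trans[OF sum_abs] sum_mono)
  fix a s'
  have "pmf \<phi> a * pmf (p a) s' \<le> 1"
    by (intro mult_le_one) (auto simp: pmf_le_1)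
  then show "\<bar>pmf \<phi> a * pmf (p a) s' * (r (s, a) - \<alpha> + u s')\<bar> \<le> \<bar>r (s, a) - \<alpha> + u s'\<bar>"
    by (auto simp: abs_mult intro!: mult_left_le_one_le)
qed

end

theory Submission
  imports Defs
begin

text \<open>
  A solution \<open>(u, \<alpha>)\<close> of the Bellman equation turns the long-run average into a telescoping sum.
  Call \<open>bellman_sum r \<alpha> u s \<phi> p - u s\<close> the Bellman gap at \<open>s\<close>. It is the conditional expectation
  of \<open>r (X\<^sub>k, A\<^sub>k) - \<alpha> + u (X\<^sub>k\<^sub>+\<^sub>1) - u (X\<^sub>k)\<close> given the history up to time \<open>k\<close>. Hence, for all
  policies of both players, the expected total reward up to time \<open>n\<close> is \<open>n \<alpha>\<close> plus the expected
  gaps collected on the way plus the boundary term \<open>E u (X\<^sub>0) - E u (X\<^sub>n)\<close>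
  (\<open>expected_total_reward\<close>). The boundary term is bounded because there are finitely many states,
  so dividing by \<open>n\<close> removes it: a uniform bound \<open>b\<close> on the gaps bounds the average by \<open>\<alpha> + b\<close>,
  from below (\<open>alpha_lower_ge\<close>) and from above (\<open>alpha_upper_le\<close>).

  Under \<open>\<Delta>\<close> all gaps are at least \<open>-\<epsilon>\<close>, whichever kernels the adversary uses and whatever
  history they depend on, so \<open>\<Delta>\<close> guarantees \<open>\<alpha> - \<epsilon>\<close>. Conversely, no stationary policy secures
  more than \<open>\<alpha>\<close>: for \<open>\<eta> > 0\<close> the Bellman equation gives in each state a kernel with gap below
  \<open>\<eta>\<close>, and since the controller is stationary and the ambiguity set rectangular, these kernels
  together form a single stationary adversary. Stationary adversaries belong to both classes \<open>K\<close>,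
  so both cases follow at once.
\<close>

section \<open>Expected rewards and Bellman gaps\<close>

lemma finite_set_hist_law:
  fixes \<pi> :: "('s::finite, 'a::finite) controller"
  shows "finite (set_pmf (hist_law \<mu> \<pi> \<kappa> n))"
  by (induction n) auto

lemma integrable_hist_law [simp]:
  fixes \<pi> :: "('s::finite, 'a::finite) controller" and f :: "_ \<Rightarrow> real"
  shows "integrable (measure_pmf (hist_law \<mu> \<pi> \<kappa> n)) f"
  by (rule integrable_measure_pmf_finite[OF finite_set_hist_law])

lemma expectation_hist_law_Suc:
  fixes \<pi> :: "('s::finite, 'a::finite) controller" and f :: "_ \<Rightarrow> real"
  shows "measure_pmf.expectation (hist_law \<mu> \<pi> \<kappa> (Suc n)) f =
    measure_pmf.expectation (hist_law \<mu> \<pi> \<kappa> n)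
      (\<lambda>(hs, s). \<Sum>a\<in>UNIV. \<Sum>s'\<in>UNIV.
        pmf (\<pi> hs s) a * pmf (\<kappa> hs s a) s' * f (hs @ [(s, a)], s'))"
proof -
  have step: "measure_pmf.expectation
        (bind_pmf (\<pi> hs s) (\<lambda>a. map_pmf (\<lambda>s'. (hs @ [(s, a)], s')) (\<kappa> hs s a))) f =
      (\<Sum>a\<in>UNIV. \<Sum>s'\<in>UNIV. pmf (\<pi> hs s) a * pmf (\<kappa> hs s a) s' * f (hs @ [(s, a)], s'))"
    for hs s
    by (subst pmf_expectation_bind[where A = UNIV])
       (auto simp: integral_measure_pmf[where A = UNIV] sum_distrib_left mult.assoc)
  show ?thesis
    by (simp only: hist_law.simps case_prod_unfold,
        subst pmf_expectation_bind[where A = "set_pmf (hist_law \<mu> \<pi> \<kappa> n)"])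
       (simp_all add: finite_set_hist_law step integral_measure_pmf[OF finite_set_hist_law]
         del: integral_sum')
qed

definition bellman_gap ::
  "('s::finite \<times> 'a::finite \<Rightarrow> real) \<Rightarrow> real \<Rightarrow> ('s \<Rightarrow> real) \<Rightarrow> 's \<Rightarrow> 'a pmf \<Rightarrow> ('a \<Rightarrow> 's pmf) \<Rightarrow> real"
  where "bellman_gap r \<alpha> u s \<phi> p = bellman_sum r \<alpha> u s \<phi> p - u s"

lemma sum_pmf_pair:
  fixes \<phi> :: "'a::finite pmf" and p :: "'a \<Rightarrow> 's::finite pmf"
  shows "(\<Sum>a\<in>UNIV. \<Sum>s'\<in>UNIV. pmf \<phi> a * pmf (p a) s') = 1"
  by (simp add: sum_distrib_left[symmetric] sum_pmf_eq_1)

text \<open>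
  The induction step is the conditional expectation of \<open>total reward + u (current state)\<close> one step
  ahead. The process obtained by subtracting from this sum \<open>\<alpha>\<close> and the gap at every step is a
  martingale.
\<close>

lemma expected_total_reward:
  fixes r :: "'s::finite \<times> 'a::finite \<Rightarrow> real"
  shows "measure_pmf.expectation (hist_law \<mu> \<pi> \<kappa> n) (\<lambda>(hs, s). (\<Sum>k<n. r (hs ! k)) + u s) =
    measure_pmf.expectation \<mu> u + real n * \<alpha> +
    (\<Sum>k<n. measure_pmf.expectation (hist_law \<mu> \<pi> \<kappa> k)
      (\<lambda>(hs, s). bellman_gap r \<alpha> u s (\<pi> hs s) (\<kappa> hs s)))"
    (is "?W n = _")
proof (induction n)
  case 0
  show ?case by simp
next
  case (Suc n)
  let ?H = "hist_law \<mu> \<pi> \<kappa> n"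
  have one_step: "(\<Sum>a\<in>UNIV. \<Sum>s'\<in>UNIV. pmf (\<pi> hs s) a * pmf (\<kappa> hs s a) s' *
        ((\<Sum>k<Suc n. r ((hs @ [(s, a)]) ! k)) + u s')) =
      ((\<Sum>k<n. r (hs ! k)) + u s) + (\<alpha> + bellman_gap r \<alpha> u s (\<pi> hs s) (\<kappa> hs s))"
    if "(hs, s) \<in> set_pmf ?H" for hs s
  proof -
    have len: "length hs = n"
      using that by (rule length_hist_law)
    define R where "R = (\<Sum>k<n. r (hs ! k))"
    have "(\<Sum>a\<in>UNIV. \<Sum>s'\<in>UNIV. pmf (\<pi> hs s) a * pmf (\<kappa> hs s a) s' *
          ((\<Sum>k<Suc n. r ((hs @ [(s, a)]) ! k)) + u s')) =
        (\<Sum>a\<in>UNIV. \<Sum>s'\<in>UNIV. (pmf (\<pi> hs s) a * pmf (\<kappa> hs s a) s') * (R + \<alpha>) +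
          pmf (\<pi> hs s) a * pmf (\<kappa> hs s a) s' * (r (s, a) - \<alpha> + u s'))"
      by (intro sum.cong refl) (simp add: R_def nth_append len algebra_simps)
    also have "\<dots> = (\<Sum>a\<in>UNIV. \<Sum>s'\<in>UNIV. pmf (\<pi> hs s) a * pmf (\<kappa> hs s a) s') * (R + \<alpha>) +
        bellman_sum r \<alpha> u s (\<pi> hs s) (\<kappa> hs s)"
      by (simp add: sum.distrib bellman_sum_def sum_distrib_right)
    finally show ?thesis
      by (simp add: sum_pmf_pair R_def bellman_gap_def)
  qed
  have "?W (Suc n) = measure_pmf.expectation ?H (\<lambda>(hs, s). ((\<Sum>k<n. r (hs ! k)) + u s) +
      (\<alpha> + bellman_gap r \<alpha> u s (\<pi> hs s) (\<kappa> hs s)))"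
    unfolding expectation_hist_law_Suc
    by (intro integral_cong_AE AE_pmfI)
       (auto simp: one_step simp del: sum.lessThan_Suc)
  also have "\<dots> = ?W n + (\<alpha> + measure_pmf.expectation ?H
      (\<lambda>(hs, s). bellman_gap r \<alpha> u s (\<pi> hs s) (\<kappa> hs s)))"
    by (simp add: case_prod_unfold)
  finally show ?case
    using Suc.IH by (simp add: algebra_simps)
qed

lemma abs_expectation_le_sum:
  fixes u :: "'s::finite \<Rightarrow> real"
  shows "\<bar>measure_pmf.expectation p (\<lambda>x. u (f x))\<bar> \<le> (\<Sum>s\<in>UNIV. \<bar>u s\<bar>)"
proof -
  have "\<bar>measure_pmf.expectation (map_pmf f p) u\<bar> \<le> (\<Sum>s\<in>UNIV. \<bar>u s\<bar>)"
    by (subst integral_measure_pmf[of UNIV])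
       (auto intro!: order_trans[OF sum_abs] sum_mono mult_left_le_one_le
         simp: abs_mult pmf_le_1)
  then show ?thesis by simp
qed

text \<open>
  The error is the boundary term \<open>E u (X\<^sub>0) - E u (X\<^sub>n)\<close>, whose bound depends neither on the
  policies nor on \<open>n\<close>.
\<close>

lemma avg_reward_approx:
  fixes r :: "'s::finite \<times> 'a::finite \<Rightarrow> real"
  shows "\<bar>avg_reward r \<mu> \<pi> \<kappa> n - 1 / real n * (real n * \<alpha> +
      (\<Sum>k<n. measure_pmf.expectation (hist_law \<mu> \<pi> \<kappa> k)
        (\<lambda>(hs, s). bellman_gap r \<alpha> u s (\<pi> hs s) (\<kappa> hs s))))\<bar>
    \<le> 1 / real n * (2 * (\<Sum>s\<in>UNIV. \<bar>u s\<bar>))"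
    (is "\<bar>_ - 1 / real n * ?T\<bar> \<le> 1 / real n * (2 * ?B)")
proof -
  let ?H = "hist_law \<mu> \<pi> \<kappa> n"
  have "avg_reward r \<mu> \<pi> \<kappa> n =
      1 / real n * (measure_pmf.expectation ?H (\<lambda>(hs, s). (\<Sum>k<n. r (hs ! k)) + u s) -
        measure_pmf.expectation ?H (\<lambda>x. u (snd x)))"
    by (simp add: avg_reward_def case_prod_unfold)
  then have "avg_reward r \<mu> \<pi> \<kappa> n - 1 / real n * ?T =
      1 / real n * (measure_pmf.expectation \<mu> u - measure_pmf.expectation ?H (\<lambda>x. u (snd x)))"
    unfolding expected_total_reward[where \<alpha> = \<alpha>]
    by (simp add: algebra_simps diff_divide_distrib add_divide_distrib)
  moreover have "\<bar>measure_pmf.expectation \<mu> u - measure_pmf.expectation ?H (\<lambda>x. u (snd x))\<bar>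
      \<le> 2 * ?B"
    using abs_expectation_le_sum[of \<mu> u "\<lambda>s. s"] abs_expectation_le_sum[of ?H u snd] by linarith
  ultimately show ?thesis
    by (simp add: abs_mult divide_right_mono)
qed

section \<open>Long-run averages\<close>

lemma alpha_lower_ge:
  fixes r :: "'s::finite \<times> 'a::finite \<Rightarrow> real"
  assumes gap: "\<And>hs s. b \<le> bellman_gap r \<alpha> u s (\<pi> hs s) (\<kappa> hs s)"
  shows "ereal (\<alpha> + b) \<le> alpha_lower r \<mu> \<pi> \<kappa>"
proof -
  let ?B = "\<Sum>s\<in>UNIV. \<bar>u s\<bar>"
  have bound: "\<alpha> + b - 1 / real n * (2 * ?B) \<le> avg_reward r \<mu> \<pi> \<kappa> n" if "n > 0" for n
  proof -
    let ?G = "\<Sum>k<n. measure_pmf.expectation (hist_law \<mu> \<pi> \<kappa> k)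
        (\<lambda>(hs, s). bellman_gap r \<alpha> u s (\<pi> hs s) (\<kappa> hs s))"
    have "(\<Sum>k<n. b) \<le> ?G"
      by (intro sum_mono measure_pmf.integral_ge_const AE_I2) (auto simp: gap)
    then have "\<alpha> + b \<le> 1 / real n * (real n * \<alpha> + ?G)"
      using that by (simp add: field_simps)
    then show ?thesis
      using avg_reward_approx[of r \<mu> \<pi> \<kappa> n \<alpha> u] by linarith
  qed
  have "(\<lambda>n. \<alpha> + b - 1 / real n * (2 * ?B)) \<longlonglongrightarrow> \<alpha> + b - 0 * (2 * ?B)"
    by (intro tendsto_intros lim_1_over_n)
  then have "liminf (\<lambda>n. ereal (\<alpha> + b - 1 / real n * (2 * ?B))) = ereal (\<alpha> + b)"
    by (intro lim_imp_Liminf) auto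
  moreover have "liminf (\<lambda>n. ereal (\<alpha> + b - 1 / real n * (2 * ?B))) \<le> alpha_lower r \<mu> \<pi> \<kappa>"
    unfolding alpha_lower_def
    by (intro Liminf_mono eventually_mono[OF eventually_gt_at_top[of 0]]) (use bound in simp)
  ultimately show ?thesis by simp
qed

lemma alpha_upper_le:
  fixes r :: "'s::finite \<times> 'a::finite \<Rightarrow> real"
  assumes gap: "\<And>hs s. bellman_gap r \<alpha> u s (\<pi> hs s) (\<kappa> hs s) \<le> b"
  shows "alpha_upper r \<mu> \<pi> \<kappa> \<le> ereal (\<alpha> + b)"
proof -
  let ?B = "\<Sum>s\<in>UNIV. \<bar>u s\<bar>"
  have bound: "avg_reward r \<mu> \<pi> \<kappa> n \<le> \<alpha> + b + 1 / real n * (2 * ?B)" if "n > 0" for n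
  proof -
    let ?G = "\<Sum>k<n. measure_pmf.expectation (hist_law \<mu> \<pi> \<kappa> k)
        (\<lambda>(hs, s). bellman_gap r \<alpha> u s (\<pi> hs s) (\<kappa> hs s))"
    have "?G \<le> (\<Sum>k<n. b)"
      by (intro sum_mono measure_pmf.integral_le_const AE_I2) (auto simp: gap)
    then have "1 / real n * (real n * \<alpha> + ?G) \<le> \<alpha> + b"
      using that by (simp add: field_simps)
    then show ?thesis
      using avg_reward_approx[of r \<mu> \<pi> \<kappa> n \<alpha> u] by linarith
  qed
  have "(\<lambda>n. \<alpha> + b + 1 / real n * (2 * ?B)) \<longlonglongrightarrow> \<alpha> + b + 0 * (2 * ?B)"
    by (intro tendsto_intros lim_1_over_n)
  then have "limsup (\<lambda>n. ereal (\<alpha> + b + 1 / real n * (2 * ?B))) = ereal (\<alpha> + b)"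
    by (intro lim_imp_Limsup) auto
  moreover have "alpha_upper r \<mu> \<pi> \<kappa> \<le> limsup (\<lambda>n. ereal (\<alpha> + b + 1 / real n * (2 * ?B)))"
    unfolding alpha_upper_def
    by (intro Limsup_mono eventually_mono[OF eventually_gt_at_top[of 0]]) (use bound in simp)
  ultimately show ?thesis by simp
qed

section \<open>The value of stationary policies\<close>

text \<open>
  Infima and suprema over the reals obey their order laws only for bounded families. The next two
  lemmas supply the bounds for the inner and the outer extremum of the Bellman equation.
\<close>

lemma bdd_below_bellman_sum: "bdd_below (bellman_sum r \<alpha> u s \<phi> ` A)"
proof (rule bdd_belowI2)
  show "- (\<Sum>a\<in>UNIV. \<Sum>s'\<in>UNIV. \<bar>r (s, a) - \<alpha> + u s'\<bar>) \<le> bellman_sum r \<alpha> u s \<phi> p" for p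
    using abs_bellman_sum_le[of r \<alpha> u s \<phi> p] by linarith
qed

lemma bdd_above_INF_bellman_sum:
  assumes "A \<noteq> {}"
  shows "bdd_above ((\<lambda>\<phi>. INF p\<in>A. bellman_sum r \<alpha> u s \<phi> p) ` Q)"
proof -
  obtain p where p: "p \<in> A" using assms by blast
  show ?thesis
  proof (rule bdd_aboveI2)
    fix \<phi>
    have "(INF p\<in>A. bellman_sum r \<alpha> u s \<phi> p) \<le> bellman_sum r \<alpha> u s \<phi> p"
      by (rule cINF_lower[OF bdd_below_bellman_sum p])
    also have "\<dots> \<le> (\<Sum>a\<in>UNIV. \<Sum>s'\<in>UNIV. \<bar>r (s, a) - \<alpha> + u s'\<bar>)"
      using abs_bellman_sum_le[of r \<alpha> u s \<phi> p] by linarith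
    finally show "(INF p\<in>A. bellman_sum r \<alpha> u s \<phi> p) \<le>
      (\<Sum>a\<in>UNIV. \<Sum>s'\<in>UNIV. \<bar>r (s, a) - \<alpha> + u s'\<bar>)" .
  qed
qed

text \<open>
  Choosing in each state a kernel that is bad for the action distribution used there gives one
  stationary adversary. The infimum over kernels need not be attained, so this adversary holds the
  controller only to \<open>\<alpha> + \<eta>\<close>; it changes with \<open>\<eta>\<close>, but the value contains an infimum over
  adversaries, so \<open>\<eta>\<close> may tend to \<open>0\<close>.
\<close>

lemma alpha_upper_value_le:
  fixes r :: "'s::finite \<times> 'a::finite \<Rightarrow> real"
  assumes P: "\<And>s. P s \<noteq> {}"
    and bellman: "\<And>s. (SUP \<phi>\<in>Q. INF p\<in>P s. bellman_sum r \<alpha> u s \<phi> p) \<le> u s"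
    and K: "K_S P \<subseteq> K"
  shows "alpha_upper_value r \<mu> (Pi_S Q) K \<le> ereal \<alpha>"
  unfolding alpha_upper_value_def
proof (rule SUP_least)
  fix \<pi> :: "('s, 'a) controller"
  assume "\<pi> \<in> Pi_S Q"
  then obtain d where \<pi>: "\<pi> = stationary d" and d: "\<And>s. d s \<in> Q"
    unfolding Pi_S_def by blast
  have "(INF \<kappa>\<in>K. alpha_upper r \<mu> \<pi> \<kappa>) \<le> ereal \<alpha> + ereal \<eta>" if "\<eta> > 0" for \<eta>
  proof -
    have "\<exists>p\<in>P s. bellman_sum r \<alpha> u s (d s) p < u s + \<eta>" for s
    proof -
      have "(INF p\<in>P s. bellman_sum r \<alpha> u s (d s) p) \<le>
          (SUP \<phi>\<in>Q. INF p\<in>P s. bellman_sum r \<alpha> u s \<phi> p)"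
        by (rule cSUP_upper[OF d bdd_above_INF_bellman_sum[OF P]])
      also have "\<dots> < u s + \<eta>"
        using bellman[of s] that by linarith
      finally show ?thesis
        by (subst (asm) cINF_less_iff[OF P bdd_below_bellman_sum])
    qed
    then obtain p where p: "\<And>s. p s \<in> P s"
      and gap: "\<And>s. bellman_sum r \<alpha> u s (d s) (p s) < u s + \<eta>"
      by metis
    have "stationary p \<in> K"
      using K p by (auto simp: K_S_def)
    moreover have "alpha_upper r \<mu> \<pi> (stationary p) \<le> ereal (\<alpha> + \<eta>)"
    proof (rule alpha_upper_le)
      show "bellman_gap r \<alpha> u s (\<pi> hs s) (stationary p hs s) \<le> \<eta>" for hs s
        using gap[of s] by (simp add: \<pi> stationary_def bellman_gap_def)
    qed
    ultimately show ?thesis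
      by (auto intro: INF_lower2)
  qed
  then show "(INF \<kappa>\<in>K. alpha_upper r \<mu> \<pi> \<kappa>) \<le> ereal \<alpha>"
    by (auto intro: ereal_le_epsilon2)
qed

lemma guarantee_of_near_optimal_policy:
  fixes r :: "'s::finite \<times> 'a::finite \<Rightarrow> real"
  assumes near_opt: "\<And>s. u s \<le> (INF p\<in>P s. bellman_sum r \<alpha> u s (\<Delta> s) p) + \<epsilon>"
    and K: "K \<subseteq> K_H P"
  shows "ereal (\<alpha> - \<epsilon>) \<le> (INF \<kappa>\<in>K. alpha_lower r \<mu> (stationary \<Delta>) \<kappa>)"
proof (rule INF_greatest)
  fix \<kappa>
  assume "\<kappa> \<in> K"
  then have \<kappa>: "\<kappa> hs s \<in> P s" for hs s
    using K by (auto simp: K_H_def)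
  have "- \<epsilon> \<le> bellman_gap r \<alpha> u s (stationary \<Delta> hs s) (\<kappa> hs s)" for hs s
  proof -
    have "(INF p\<in>P s. bellman_sum r \<alpha> u s (\<Delta> s) p) \<le> bellman_sum r \<alpha> u s (\<Delta> s) (\<kappa> hs s)"
      by (rule cINF_lower[OF bdd_below_bellman_sum \<kappa>])
    then show ?thesis
      using near_opt[of s] by (simp add: stationary_def bellman_gap_def)
  qed
  then have "ereal (\<alpha> + - \<epsilon>) \<le> alpha_lower r \<mu> (stationary \<Delta>) \<kappa>"
    by (rule alpha_lower_ge)
  then show "ereal (\<alpha> - \<epsilon>) \<le> alpha_lower r \<mu> (stationary \<Delta>) \<kappa>"
    by simp
qed

theorem theorem3:
  fixes r :: "'s::finite \<times> 'a::finite \<Rightarrow> real"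
    and Q :: "'a pmf set"
    and P :: "'s \<Rightarrow> ('a \<Rightarrow> 's pmf) set"
    and u :: "'s \<Rightarrow> real" and \<alpha> \<epsilon> :: real
    and \<Delta> :: "'s \<Rightarrow> 'a pmf"
    and \<mu> :: "'s pmf"
    and K :: "('s, 'a) adversary set"
  assumes r: "\<And>s a. r (s, a) \<in> {0..1}"
    and Q: "Q \<noteq> {}"
    and P: "\<And>s. P s \<noteq> {}"
    and \<alpha>: "\<alpha> \<in> {0..1}"
    and bellman: "\<And>s. u s = (SUP \<phi>\<in>Q. INF p\<in>P s. bellman_sum r \<alpha> u s \<phi> p)"
    and \<epsilon>: "\<epsilon> \<ge> 0"
    and \<Delta>: "\<And>s. \<Delta> s \<in> Q"
    and near_opt: "\<And>s. u s \<le> (INF p\<in>P s. bellman_sum r \<alpha> u s (\<Delta> s) p) + \<epsilon>"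
    and K: "K = K_H P \<or> K = K_S P"
  shows "alpha_upper_value r \<mu> (Pi_S Q) K
           - (INF \<kappa>\<in>K. alpha_lower r \<mu> (stationary \<Delta>) \<kappa>) \<le> ereal \<epsilon>"
proof -
  have "K_S P \<subseteq> K" "K \<subseteq> K_H P"
    using K K_S_subset_K_H by blast+
  then have "alpha_upper_value r \<mu> (Pi_S Q) K \<le> ereal \<alpha>"
    and "ereal (\<alpha> - \<epsilon>) \<le> (INF \<kappa>\<in>K. alpha_lower r \<mu> (stationary \<Delta>) \<kappa>)"
    using alpha_upper_value_le[OF P eq_refl[OF bellman[symmetric]]]
      guarantee_of_near_optimal_policy[OF near_opt] by blast+
  then have "alpha_upper_value r \<mu> (Pi_S Q) K
      - (INF \<kappa>\<in>K. alpha_lower r \<mu> (stationary \<Delta>) \<kappa>) \<le> ereal \<alpha> - ereal (\<alpha> - \<epsilon>)"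
    by (rule ereal_minus_mono)
  then show ?thesis
    by simp
qed

end
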